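(* Let $X$ be a real normed linear space, $\Omega\subseteq X$ a nonempty closed set, $v\in X$ nonzero, $T(x):=\inf\{t\ge 0\mid x+tv\in\Omega\}$, and $s>0$. For any $\bar x\in\operatorname{dom}T\setminus\Omega$, with $\tilde x:=\bar x+T(\bar x)v$, one has $$\partial_sT(\bar x)\subseteq\{x^*\in X^*\mid\langle x^*,v\rangle=-1\}\cap N_s(\tilde x;\Omega).$$ Suppose further that $T$ is lower calm at $\bar x$. Then $$\partial_sT(\bar x)=\{x^*\in X^*\mid\langle x^*,v\rangle=-1\}\cap N_s(\tilde x;\Omega).$$
   Context: $T$ takes values in $[0,\infty]$ with $\inf\emptyset=\infty$, and $\operatorname{dom}T:=\{x\mid T(x)<\infty\}$; for $x\in\operatorname{dom}T$ the point $x+T(x)v$ lies in $\Omega$. $X^*$ is the topological dual of $X$; $B(x;\delta)$ is the closed ball. For $\psi:X\to(-\infty,\infty]$ and $\bar x\in\operatorname{dom}\psi$, the $s$-Hölder subdifferential $\partial_s\psi(\bar x)$ is the set of $x^*\in X^*$ for which there exist $\delta>0$, $\sigma>0$ such that $\langle x^*,x-\bar x\rangle\le\psi(x)-\psi(\bar x)+\sigma\|x-\bar x\|^{1+s}$ for all $x\in B(\bar x;\delta)$. For $y\in\Omega$, the $s$-Hölder normal cone $N_s(y;\Omega)$ is the set of $x^*\in X^*$ for which there exist $\delta>0$, $\sigma>0$ such that $\langle x^*,x-y\rangle\le\sigma\|x-y\|^{1+s}$ for all $x\in B(y;\delta)\cap\Omega$. A function $\psi$ is lower calm at $\bar x\in\operatorname{dom}\psi$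 if there exist $\ell\in\mathbb R$ and $\delta>0$ such that $\psi(x)-\psi(\bar x)\ge\ell\|x-\bar x\|$ for all $x\in B(\bar x;\delta)$. *)

theory Defs
  imports "HOL-Analysis.Analysis"
begin

text \<open>
  Functions with values in \<open>(-\<infinity>,\<infinity>]\<close> are rendered as functions into \<^typ>\<open>ereal\<close>, and the
  topological dual of \<open>X\<close> as the space of bounded linear functionals
  \<open>X \<Rightarrow>\<^sub>L real\<close>.  Since \<open>Inf {} = \<infinity>\<close> in \<^typ>\<open>ereal\<close>, the convention on the infimum of the
  empty set is the library's.
\<close>

definition min_time :: "'a::real_normed_vector set \<Rightarrow> 'a \<Rightarrow> 'a \<Rightarrow> ereal" where
  "min_time \<Omega> v x = (INF t\<in>{t::real. 0 \<le> t \<and> x + t *\<^sub>R v \<in> \<Omega>}. ereal t)"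

definition eff_dom :: "('a \<Rightarrow> ereal) \<Rightarrow> 'a set" where
  "eff_dom \<psi> = {x. \<psi> x < \<infinity>}"

text \<open>
  The next two notions are meaningful only for functions that never take the value \<open>-\<infinity>\<close> and at
  points \<open>xb \<in> eff_dom \<psi>\<close>; there the \<^typ>\<open>ereal\<close> difference \<open>\<psi> x - \<psi> xb\<close> subtracts a finite
  number.
\<close>

definition Hoelder_subdifferential ::
    "real \<Rightarrow> ('a::real_normed_vector \<Rightarrow> ereal) \<Rightarrow> 'a \<Rightarrow> ('a \<Rightarrow>\<^sub>L real) set" where
  "Hoelder_subdifferential s \<psi> xb =
     {x'. \<exists>\<delta>>0. \<exists>\<sigma>>0. \<forall>x\<in>cball xb \<delta>.
        ereal (blinfun_apply x' (x - xb))
          \<le> \<psi> x - \<psi> xb + ereal (\<sigma> * norm (x - xb) powr (1 + s))}"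

definition lower_calm_at :: "('a::real_normed_vector \<Rightarrow> ereal) \<Rightarrow> 'a \<Rightarrow> bool" where
  "lower_calm_at \<psi> xb \<longleftrightarrow>
     (\<exists>l::real. \<exists>\<delta>>0. \<forall>x\<in>cball xb \<delta>. \<psi> x - \<psi> xb \<ge> ereal (l * norm (x - xb)))"

text \<open>Meaningful only for \<open>y \<in> \<Omega>\<close>.\<close>

definition Hoelder_normal_cone ::
    "real \<Rightarrow> 'a::real_normed_vector \<Rightarrow> 'a set \<Rightarrow> ('a \<Rightarrow>\<^sub>L real) set" where
  "Hoelder_normal_cone s y \<Omega> =
     {x'. \<exists>\<delta>>0. \<exists>\<sigma>>0. \<forall>x\<in>cball y \<delta> \<inter> \<Omega>.
        blinfun_apply x' (x - y) \<le> \<sigma> * norm (x - y) powr (1 + s)}"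

end

theory Submission
  imports Defs
begin

text \<open>
  The minimum is attained, so \<open>xt\<close> lies in \<open>\<Omega>\<close>. For small \<open>h > 0\<close>, \<open>T (xb + h v) \<le> T xb - h\<close> and
  \<open>T (xb - h v) \<le> T xb + h\<close>, which forces \<open>\<langle>x', v\<rangle> = -1\<close>; and \<open>T (xb + (y - xt)) \<le> T xb\<close> for \<open>y \<in> \<Omega>\<close>, which turns the
  subgradient inequality into the normal cone inequality.
  Conversely, if \<open>T x - T xb \<ge> \<parallel>x'\<parallel> \<parallel>x - xb\<parallel>\<close> the subgradient inequality is trivial. Otherwise
  lower calmness gives \<open>\<bar>T x - T xb\<bar> \<le> M \<parallel>x - xb\<parallel>\<close>, so \<open>y = x + T x v\<close> satisfies
  \<open>\<parallel>y - xt\<parallel> \<le> (1 + M \<parallel>v\<parallel>) \<parallel>x - xb\<parallel>\<close>, and \<open>\<langle>x', y - xt\<rangle> = \<langle>x', x - xb\<rangle> - (T x - T xb)\<close> yields the claim.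
\<close>

lemma min_time_le:
  assumes "0 \<le> t" "x + t *\<^sub>R v \<in> \<Omega>"
  shows "min_time \<Omega> v x \<le> ereal t"
  unfolding min_time_def using assms by (intro INF_lower) auto

text \<open>The admissible times are the part in \<open>{0..}\<close> of the preimage of a closed
  set under the continuous map \<open>t \<mapsto> x + t *\<^sub>R v\<close>. This set is closed,
  bounded below and, as the infimum is finite, nonempty; so it contains its infimum.\<close>

lemma min_time_attained:
  assumes "closed \<Omega>" "min_time \<Omega> v x < \<infinity>"
  obtains t where "0 \<le> t" "x + t *\<^sub>R v \<in> \<Omega>" "min_time \<Omega> v x = ereal t"
proof -
  define A where "A = {t::real. 0 \<le> t \<and> x + t *\<^sub>R v \<in> \<Omega>}"
  have "A \<noteq> {}"
  proof
    assume "A = {}"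
    then have "min_time \<Omega> v x = \<infinity>"
      unfolding min_time_def A_def[symmetric] by (simp add: top_ereal_def)
    with assms show False by simp
  qed
  have "closed A"
  proof -
    have "A = {0..} \<inter> (\<lambda>t. x + t *\<^sub>R v) -` \<Omega>"
      unfolding A_def by auto
    moreover have "closed ((\<lambda>t::real. x + t *\<^sub>R v) -` \<Omega>)"
      by (intro closed_vimage assms continuous_intros)
    ultimately show ?thesis by (simp add: closed_Int)
  qed
  have bdd: "bdd_below A"
    unfolding A_def by (rule bdd_belowI[of _ 0]) auto
  have mem: "Inf A \<in> A"
    using closed_contains_Inf \<open>A \<noteq> {}\<close> bdd \<open>closed A\<close> by blast
  have "min_time \<Omega> v x = ereal (Inf A)"
  proof (rule antisym)
    show "min_time \<Omega> v x \<le> ereal (Inf A)"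
      using mem by (intro min_time_le) (auto simp: A_def)
    show "ereal (Inf A) \<le> min_time \<Omega> v x"
      unfolding min_time_def A_def[symmetric]
      by (intro INF_greatest) (simp add: cInf_lower bdd)
  qed
  with mem that show thesis by (auto simp: A_def)
qed

text \<open>Division by \<open>h > 0\<close> leaves \<open>a \<le> C * h powr s\<close>, whose right
  side tends to 0 because \<open>s > 0\<close>.\<close>

lemma nonpos_of_eventually_le_powr:
  fixes a C s :: real
  assumes "s > 0" and ev: "\<forall>\<^sub>F h in at_right 0. a * h \<le> C * h powr (1 + s)"
  shows "a \<le> 0"
proof -
  have "((\<lambda>h. C * h powr s) \<longlongrightarrow> C * 0 powr s) (at_right 0)"
    using \<open>s > 0\<close> by (intro tendsto_intros) (auto simp: eventually_at_filter)
  then have lim: "((\<lambda>h. C * h powr s) \<longlongrightarrow> 0) (at_right 0)" by simp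
  have "\<forall>\<^sub>F h in at_right 0. a \<le> C * h powr s"
    using ev eventually_at_right_less[of "0::real"]
  proof eventually_elim
    case (elim h)
    then have "a * h \<le> (C * h powr s) * h" by (simp add: powr_add mult_ac)
    with elim show ?case by simp
  qed
  with tendsto_lowerbound[OF lim] show ?thesis by simp
qed

text \<open>Along the ray \<open>xb + h *\<^sub>R w\<close> the error term has order
  \<open>h powr (1 + s)\<close>, so only the first-order terms survive as \<open>h\<close> tends to
  0 from the right. Used with \<open>w = v\<close> and \<open>w = - v\<close>, this bounds
  \<open>blinfun_apply x' v\<close> from both sides.\<close>

lemma Hoelder_subgradient_directional_le:
  assumes "s > 0" "x' \<in> Hoelder_subdifferential s \<psi> xb" "\<psi> xb = ereal t0"
    and ev: "\<forall>\<^sub>F h in at_right 0. \<psi> (xb + h *\<^sub>R w) \<le> ereal (t0 + h * c)"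
  shows "blinfun_apply x' w \<le> c"
proof -
  obtain \<delta> \<sigma> where "\<delta> > 0" and sub: "\<And>x. x \<in> cball xb \<delta> \<Longrightarrow> ereal (blinfun_apply x' (x - xb))
          \<le> \<psi> x - \<psi> xb + ereal (\<sigma> * norm (x - xb) powr (1 + s))"
    using assms(2) unfolding Hoelder_subdifferential_def by blast
  have "((\<lambda>h. norm (h *\<^sub>R w)) \<longlongrightarrow> norm (0 *\<^sub>R w)) (at_right 0)"
    by (intro tendsto_intros)
  then have "\<forall>\<^sub>F h in at_right 0. norm (h *\<^sub>R w) < \<delta>"
    using \<open>\<delta> > 0\<close> by (intro order_tendstoD) auto
  then have "\<forall>\<^sub>F h in at_right 0. (blinfun_apply x' w - c) * h
               \<le> (\<sigma> * norm w powr (1 + s)) * h powr (1 + s)"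
    using ev eventually_at_right_less[of "0::real"]
  proof eventually_elim
    case (elim h)
    then have "xb + h *\<^sub>R w \<in> cball xb \<delta>" by (simp add: dist_norm)
    from sub[OF this] have "ereal (h * blinfun_apply x' w)
        \<le> \<psi> (xb + h *\<^sub>R w) - ereal t0 + ereal (\<sigma> * norm (h *\<^sub>R w) powr (1 + s))"
      using assms(3) by (simp add: blinfun.scaleR_right)
    also have "\<dots> \<le> ereal (t0 + h * c) - ereal t0 + ereal (\<sigma> * norm (h *\<^sub>R w) powr (1 + s))"
      using elim by (intro add_right_mono ereal_minus_mono) auto
    finally have "h * blinfun_apply x' w \<le> h * c + \<sigma> * norm (h *\<^sub>R w) powr (1 + s)"
      by simp
    with elim show ?case by (simp add: powr_mult algebra_simps)
  qed
  with nonpos_of_eventually_le_powr[OF \<open>s > 0\<close>] show ?thesis by fastforce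
qed

lemma Hoelder_subdifferential_min_time_subset:
  assumes "s > 0" "0 < t0" "min_time \<Omega> v xb = ereal t0" "xb + t0 *\<^sub>R v \<in> \<Omega>"
  shows "Hoelder_subdifferential s (min_time \<Omega> v) xb
           \<subseteq> {x'. blinfun_apply x' v = -1} \<inter> Hoelder_normal_cone s (xb + t0 *\<^sub>R v) \<Omega>"
proof
  fix x' assume x': "x' \<in> Hoelder_subdifferential s (min_time \<Omega> v) xb"
  have "blinfun_apply x' v \<le> -1"
  proof (rule Hoelder_subgradient_directional_le[OF assms(1) x' assms(3)])
    show "\<forall>\<^sub>F h in at_right 0. min_time \<Omega> v (xb + h *\<^sub>R v) \<le> ereal (t0 + h * -1)"
      \<comment> \<open>The landing point stays the same and the remaining time is
        \<open>t0 - h\<close>. It must be nonnegative, hence the restriction \<open>h < t0\<close>,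
        which needs \<open>t0 > 0\<close>.\<close>
      using eventually_at_right_real[OF \<open>0 < t0\<close>]
    proof eventually_elim
      case (elim h)
      then show ?case
        using assms(4) by (intro min_time_le) (auto simp: algebra_simps)
    qed
  qed
  moreover have "blinfun_apply x' (- v) \<le> 1"
  proof (rule Hoelder_subgradient_directional_le[OF assms(1) x' assms(3)])
    show "\<forall>\<^sub>F h in at_right 0. min_time \<Omega> v (xb + h *\<^sub>R - v) \<le> ereal (t0 + h * 1)"
      using eventually_at_right_less[of "0::real"]
    proof eventually_elim
      case (elim h)
      then show ?case
        using assms by (intro min_time_le) (auto simp: algebra_simps)
    qed
  qed
  ultimately have "blinfun_apply x' v = -1" by (simp add: blinfun.minus_right)
  moreover have "x' \<in> Hoelder_normal_cone s (xb + t0 *\<^sub>R v) \<Omega>"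
  proof -
    let ?xt = "xb + t0 *\<^sub>R v"
    obtain \<delta> \<sigma> where "\<delta> > 0" "\<sigma> > 0"
      and sub: "\<And>x. x \<in> cball xb \<delta> \<Longrightarrow> ereal (blinfun_apply x' (x - xb))
          \<le> min_time \<Omega> v x - min_time \<Omega> v xb + ereal (\<sigma> * norm (x - xb) powr (1 + s))"
      using x' unfolding Hoelder_subdifferential_def by blast
    have "blinfun_apply x' (y - ?xt) \<le> \<sigma> * norm (y - ?xt) powr (1 + s)"
      if y: "y \<in> cball ?xt \<delta> \<inter> \<Omega>" for y
    proof -
      \<comment> \<open>This is \<open>y - t0 *\<^sub>R v\<close>: it reaches \<open>y\<close> in
        time \<open>t0\<close> and has the same displacement from \<open>xb\<close> as
        \<open>y\<close> from \<open>?xt\<close>, so \<open>\<delta>\<close> and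
        \<open>\<sigma>\<close> carry over unchanged.\<close>
      define x where "x = xb + (y - ?xt)"
      have x_diff: "x - xb = y - ?xt" and "x + t0 *\<^sub>R v = y" by (simp_all add: x_def)
      with y \<open>0 < t0\<close> have le: "min_time \<Omega> v x \<le> ereal t0" by (intro min_time_le) auto
      have "dist xb x = dist ?xt y"
        using x_diff by (metis dist_norm dist_commute)
      with y have "x \<in> cball xb \<delta>" by simp
      from sub[OF this] have "ereal (blinfun_apply x' (y - ?xt))
          \<le> min_time \<Omega> v x - ereal t0 + ereal (\<sigma> * norm (y - ?xt) powr (1 + s))"
        unfolding x_diff assms(3) .
      also have "\<dots> \<le> ereal t0 - ereal t0 + ereal (\<sigma> * norm (y - ?xt) powr (1 + s))"
        using le by (intro add_right_mono ereal_minus_mono) auto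
      finally show ?thesis by simp
    qed
    with \<open>\<delta> > 0\<close> \<open>\<sigma> > 0\<close> show ?thesis
      unfolding Hoelder_normal_cone_def by blast
  qed
  ultimately show "x' \<in> {x'. blinfun_apply x' v = -1} \<inter> Hoelder_normal_cone s (xb + t0 *\<^sub>R v) \<Omega>"
    by simp
qed

lemma Hoelder_normal_in_subdifferential_min_time:
  assumes "s > 0" "closed \<Omega>" "min_time \<Omega> v xb = ereal t0"
    and calm: "lower_calm_at (min_time \<Omega> v) xb"
    and x'v: "blinfun_apply x' v = -1"
    and x'N: "x' \<in> Hoelder_normal_cone s (xb + t0 *\<^sub>R v) \<Omega>"
  shows "x' \<in> Hoelder_subdifferential s (min_time \<Omega> v) xb"
proof -
  let ?xt = "xb + t0 *\<^sub>R v"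
  obtain l \<delta>1 where "\<delta>1 > 0" and calm': "\<And>x. x \<in> cball xb \<delta>1 \<Longrightarrow>
      min_time \<Omega> v x - ereal t0 \<ge> ereal (l * norm (x - xb))"
    using calm assms(3) unfolding lower_calm_at_def by metis
  obtain \<delta>2 \<sigma> where "\<delta>2 > 0" "\<sigma> > 0" and N: "\<And>y. y \<in> cball ?xt \<delta>2 \<Longrightarrow> y \<in> \<Omega> \<Longrightarrow>
      blinfun_apply x' (y - ?xt) \<le> \<sigma> * norm (y - ?xt) powr (1 + s)"
    using x'N unfolding Hoelder_normal_cone_def by blast
  \<comment> \<open>\<open>\<bar>l\<bar>\<close> serves the lower bound on \<open>t - t0\<close>
    from calmness, \<open>norm x'\<close> the upper bound in the nontrivial case below.\<close>
  define M where "M = max \<bar>l\<bar> (norm x')"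
  \<comment> \<open>\<open>K\<close> bounds the displacement of the landing point relative to
    \<open>norm (x - xb)\<close>. Hence the radius \<open>\<delta>2 / K\<close> keeps that point
    within \<open>\<delta>2\<close> of \<open>?xt\<close>, and \<open>\<tau>\<close> absorbs the
    factor \<open>K powr (1 + s)\<close>.\<close>
  define K where "K = 1 + M * norm v"
  have "M \<ge> 0" by (simp add: M_def)
  then have "K \<ge> 1" by (simp add: K_def)
  define \<delta> where "\<delta> = min \<delta>1 (\<delta>2 / K)"
  define \<tau> where "\<tau> = \<sigma> * K powr (1 + s)"
  have "\<delta> > 0" using \<open>\<delta>1 > 0\<close> \<open>\<delta>2 > 0\<close> \<open>K \<ge> 1\<close> by (simp add: \<delta>_def)
  have "\<tau> > 0" using \<open>\<sigma> > 0\<close> \<open>K \<ge> 1\<close> by (simp add: \<tau>_def)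
  have "ereal (blinfun_apply x' (x - xb))
      \<le> min_time \<Omega> v x - min_time \<Omega> v xb + ereal (\<tau> * norm (x - xb) powr (1 + s))"
    if x: "x \<in> cball xb \<delta>" for x
  proof (cases "min_time \<Omega> v x < \<infinity>")
    \<comment> \<open>Off the effective domain the right-hand side is infinite.\<close>
    case False
    then show ?thesis by (simp add: assms(3))
  next
    case True
    then obtain t where t: "x + t *\<^sub>R v \<in> \<Omega>" "min_time \<Omega> v x = ereal t"
      using min_time_attained[OF \<open>closed \<Omega>\<close>] by metis
    have x_near: "norm (x - xb) \<le> \<delta>1" "norm (x - xb) \<le> \<delta>2 / K"
      using x by (simp_all add: \<delta>_def dist_norm norm_minus_commute)
    have "blinfun_apply x' (x - xb) \<le> t - t0 + \<tau> * norm (x - xb) powr (1 + s)"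
    proof (cases "t - t0 \<le> norm x' * norm (x - xb)")
      case False
      moreover have "blinfun_apply x' (x - xb) \<le> norm x' * norm (x - xb)"
        using norm_blinfun[of x' "x - xb"] by simp
      moreover have "0 \<le> \<tau> * norm (x - xb) powr (1 + s)" using \<open>\<tau> > 0\<close> by simp
      ultimately show ?thesis by linarith
    next
      case True
      define y where "y = x + t *\<^sub>R v"
      have y_diff: "y - ?xt = (x - xb) + (t - t0) *\<^sub>R v"
        by (simp add: y_def algebra_simps)
      have "l * norm (x - xb) \<le> t - t0"
        using calm'[of x] x_near t by (simp add: dist_norm norm_minus_commute)
      moreover have "(- M) * norm (x - xb) \<le> l * norm (x - xb)"
        by (intro mult_right_mono) (auto simp: M_def)
      moreover have "norm x' * norm (x - xb) \<le> M * norm (x - xb)"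
        by (intro mult_right_mono) (auto simp: M_def)
      ultimately have "\<bar>t - t0\<bar> \<le> M * norm (x - xb)"
        using True by linarith
      then have "\<bar>t - t0\<bar> * norm v \<le> M * norm (x - xb) * norm v"
        by (rule mult_right_mono) simp
      moreover have "norm (y - ?xt) \<le> norm (x - xb) + \<bar>t - t0\<bar> * norm v"
        unfolding y_diff using norm_triangle_ineq[of "x - xb" "(t - t0) *\<^sub>R v"] by simp
      ultimately have y_le: "norm (y - ?xt) \<le> K * norm (x - xb)"
        by (simp add: K_def algebra_simps)
      also have "\<dots> \<le> \<delta>2"
        using x_near \<open>K \<ge> 1\<close> by (simp add: field_simps)
      finally have "y \<in> cball ?xt \<delta>2" by (simp add: dist_norm norm_minus_commute)
      with N t have "blinfun_apply x' (y - ?xt) \<le> \<sigma> * norm (y - ?xt) powr (1 + s)"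
        by (simp add: y_def)
      also have "\<dots> \<le> \<sigma> * (K * norm (x - xb)) powr (1 + s)"
        using y_le \<open>\<sigma> > 0\<close> \<open>s > 0\<close> by (intro mult_left_mono powr_mono2) auto
      also have "\<dots> = \<tau> * norm (x - xb) powr (1 + s)"
        using \<open>K \<ge> 1\<close> by (simp add: \<tau>_def powr_mult)
      finally show ?thesis
        unfolding y_diff by (simp add: blinfun.add_right blinfun.scaleR_right x'v)
    qed
    then show ?thesis by (simp add: t assms(3))
  qed
  with \<open>\<delta> > 0\<close> \<open>\<tau> > 0\<close> show ?thesis
    unfolding Hoelder_subdifferential_def by blast
qed

theorem theorem3p14:
  fixes \<Omega> :: "'a::real_normed_vector set" and v xb xt :: 'a and s :: real
    and T :: "'a \<Rightarrow> ereal"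
  defines "T \<equiv> min_time \<Omega> v"
    and "xt \<equiv> xb + real_of_ereal (T xb) *\<^sub>R v"
  assumes "\<Omega> \<noteq> {}" and "closed \<Omega>" and "v \<noteq> 0" and "s > 0"
    and "xb \<in> eff_dom T - \<Omega>"
  shows "Hoelder_subdifferential s T xb
           \<subseteq> {x'. blinfun_apply x' v = -1} \<inter> Hoelder_normal_cone s xt \<Omega>
       \<and> (lower_calm_at T xb \<longrightarrow>
           Hoelder_subdifferential s T xb
             = {x'. blinfun_apply x' v = -1} \<inter> Hoelder_normal_cone s xt \<Omega>)"
proof -
  have "min_time \<Omega> v xb < \<infinity>" "xb \<notin> \<Omega>"
    using assms(7) by (auto simp: T_def eff_dom_def)
  then obtain t0 where t0: "0 \<le> t0" "xb + t0 *\<^sub>R v \<in> \<Omega>" "min_time \<Omega> v xb = ereal t0"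
    using min_time_attained[OF \<open>closed \<Omega>\<close>] by metis
  \<comment> \<open>Landing at time 0 would put \<open>xb\<close> itself in
    \<open>\<Omega>\<close>.\<close>
  have "t0 \<noteq> 0" using t0(2) \<open>xb \<notin> \<Omega>\<close> by auto
  with t0 have "0 < t0" by simp
  have "xt = xb + t0 *\<^sub>R v" by (simp add: xt_def T_def t0)
  then show ?thesis
    using Hoelder_subdifferential_min_time_subset[OF \<open>s > 0\<close> \<open>0 < t0\<close> t0(3) t0(2)]
      Hoelder_normal_in_subdifferential_min_time[OF \<open>s > 0\<close> \<open>closed \<Omega>\<close> t0(3)]
    unfolding T_def by blast
qed

end
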